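(* Let $X$ be a Peano continuum and let $f:X\to X$ be a cw-expansive homeomorphism. Then for every $\varepsilon>0$ there exists $\delta>0$ such that $$\inf_{x\in X}\operatorname{diam} CW^s_\varepsilon(x)\ \ge\ \delta\qquad\text{and}\qquad \inf_{x\in X}\operatorname{diam} CW^u_\varepsilon(x)\ \ge\ \delta .$$
   Context: A Peano continuum is a compact, connected, locally connected metric space $(X,d)$ with more than one point. A homeomorphism $f:X\to X$ of a compact metric space is continuum-wise expansive (cw-expansive) if there is a constant $\alpha>0$ such that $\sup_{n\in\mathbb Z}\operatorname{diam} f^n(C)>\alpha$ for every continuum $C\subset X$ containing more than one point. For $\varepsilon>0$ and $x\in X$: $W^s_\varepsilon(x)=\{y\in X:\ d(f^n(x),f^n(y))\le\varepsilon \text{ for all } n\ge 0\}$, $W^u_\varepsilon(x)=\{y\in X:\ d(f^{-n}(x),f^{-n}(y))\le\varepsilon \text{ for all } n\ge 0\}$, and $CW^\sigma_\varepsilon(x)$ ($\sigma=s,u$) denotes the connected component of $W^\sigma_\varepsilon(x)$ containing $x$. *)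

theory Defs
  imports "HOL-Analysis.Analysis"
begin

definition peano_continuum :: "'a::metric_space set \<Rightarrow> bool" where
  "peano_continuum X \<longleftrightarrow> compact X \<and> connected X \<and> locally connected X
     \<and> (\<exists>x\<in>X. \<exists>y\<in>X. x \<noteq> y)"

definition iter_int :: "'a set \<Rightarrow> ('a \<Rightarrow> 'a) \<Rightarrow> int \<Rightarrow> 'a \<Rightarrow> 'a" where
  "iter_int X f n = (if 0 \<le> n then f ^^ nat n else inv_into X f ^^ nat (- n))"

definition cw_expansive :: "'a::metric_space set \<Rightarrow> ('a \<Rightarrow> 'a) \<Rightarrow> bool" where
  "cw_expansive X f \<longleftrightarrow> (\<exists>\<alpha>>0. \<forall>C. C \<subseteq> X \<and> compact C \<and> connected C
       \<and> (\<exists>x\<in>C. \<exists>y\<in>C. x \<noteq> y)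
       \<longrightarrow> (SUP n::int. diameter (iter_int X f n ` C)) > \<alpha>)"

definition stable_set :: "'a::metric_space set \<Rightarrow> ('a \<Rightarrow> 'a) \<Rightarrow> real \<Rightarrow> 'a \<Rightarrow> 'a set" where
  "stable_set X f \<epsilon> x = {y\<in>X. \<forall>n::nat. dist ((f ^^ n) x) ((f ^^ n) y) \<le> \<epsilon>}"

definition unstable_set :: "'a::metric_space set \<Rightarrow> ('a \<Rightarrow> 'a) \<Rightarrow> real \<Rightarrow> 'a \<Rightarrow> 'a set" where
  "unstable_set X f \<epsilon> x = {y\<in>X. \<forall>n::nat.
      dist ((inv_into X f ^^ n) x) ((inv_into X f ^^ n) y) \<le> \<epsilon>}"

definition cw_stable :: "'a::metric_space set \<Rightarrow> ('a \<Rightarrow> 'a) \<Rightarrow> real \<Rightarrow> 'a \<Rightarrow> 'a set" where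
  "cw_stable X f \<epsilon> x = connected_component_set (stable_set X f \<epsilon> x) x"

definition cw_unstable :: "'a::metric_space set \<Rightarrow> ('a \<Rightarrow> 'a) \<Rightarrow> real \<Rightarrow> 'a \<Rightarrow> 'a set" where
  "cw_unstable X f \<epsilon> x = connected_component_set (unstable_set X f \<epsilon> x) x"

end

theory Submission
  imports Defs
begin

text \<open>
  Sizes of continua are measured by radii about a base point instead of diameters, which spares the
  Hausdorff metric: the upper limit of connected sets whose base points converge is connected, and it
  inherits radius bounds. Cw-expansivity thus becomes uniform, and a small continuum that grows to a
  definite size and stays controlled up to time \<open>n\<close> still has a definite size at time \<open>n\<close>.

  A neighbourhood \<open>D\<close> with small forward iterates cannot exist: it would make all far backward
  iterates \<open>f\<^sup>-\<^sup>m x\<close> uniformly stable, so that any two points of \<open>D\<close> are recurrent along common times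
  \<open>p\<close>, while \<open>f\<^sup>p D\<close> shrinks to a point. By compactness a ball about any point grows to a definite size
  in bounded time, in either time direction. So a small ball about \<open>f\<^sup>n x\<close> grows backwards; boundary
  bumping cuts from it a continuum that stays \<open>\<epsilon>\<close>-small at the times \<open>0, ..., n\<close> backwards but
  reaches \<open>\<epsilon>\<close>, and its image at \<open>x\<close> has definite size. A limit of these images as \<open>n\<close> grows
  lies in the stable set of \<open>x\<close>.
\<close>

section \<open>Boundary bumping, limits of connected sets, uniform local connectedness\<close>

text \<open>The component of \<open>F\<close> through \<open>c\<close> meets the frontier of
  \<open>F\<close> in \<open>C\<close>, while \<open>W\<close>, being open and inside
  \<open>F\<close>, lies in the interior. The bumping theorem wants a proper subset; for
  \<open>F = C\<close> the set \<open>C\<close> itself serves. In the applications \<open>W\<close>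
  collects strict bounds and \<open>F\<close> the corresponding weak ones, so that \<open>T\<close>
  obeys all weak bounds and violates a strict one.\<close>

lemma boundary_bumping_neighbourhood:
  fixes C :: "'a::metric_space set"
  assumes "compact C" "connected C" "closedin (top_of_set C) F" "openin (top_of_set C) W"
    and "W \<subseteq> F" "c \<in> W" "\<not> C \<subseteq> W"
  obtains T where "connected T" "c \<in> T" "T \<subseteq> F" "\<not> T \<subseteq> W"
proof (cases "F = C")
  case True
  with assms that[of C] show ?thesis
    using openin_imp_subset by blast
next
  case False
  let ?T = "connected_component_of_set (subtopology (top_of_set C) F) c"
  have "F \<subseteq> C" "c \<in> F"
    using assms by (auto dest: closedin_imp_subset)
  then have sub: "subtopology (top_of_set C) F = top_of_set F"
    by (simp add: subtopology_subtopology inf.absorb2)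
  have in_comp: "?T \<in> connected_components_of (subtopology (top_of_set C) F)"
    using \<open>c \<in> F\<close> by (simp add: connected_component_in_connected_components_of sub)
  have "?T \<inter> (top_of_set C) frontier_of F \<noteq> {}"
    by (rule boundary_bumping_theorem_closed)
       (use assms False in_comp in \<open>auto simp: connected_space_subtopology compact_space_subtopology
          Hausdorff_space_subtopology\<close>)
  moreover have "W \<subseteq> (top_of_set C) interior_of F"
    by (simp add: assms interior_of_maximal)
  ultimately have "\<not> ?T \<subseteq> W"
    by (auto simp: frontier_of_def)
  moreover have "connected ?T"
    using connectedin_connected_component_of[of "top_of_set F" c]
    by (simp add: sub connectedin_subtopology)
  moreover have "c \<in> ?T" "?T \<subseteq> F"
    using \<open>c \<in> F\<close> connected_component_of_subset_topspace[of "top_of_set F" c]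
    by (auto simp: sub connected_component_of_refl)
  ultimately show ?thesis
    using that by blast
qed

text \<open>\<open>L\<close> is the upper limit of the sets \<open>C (r k)\<close> along a
  subsequence on which \<open>c\<close> and \<open>a\<close> converge. If \<open>L\<close> split,
  compactness would trap all late \<open>C (r k)\<close> in two disjoint open sets; connectedness
  would keep them in the one around \<open>c'\<close>, so nothing could accumulate in the other. The
  quantifier over \<open>h\<close> sits inside the conclusion so that one \<open>L\<close> serves
  all iterates at once.\<close>

lemma limit_continuum:
  fixes C :: "nat \<Rightarrow> 'a::metric_space set"
  assumes X: "compact X"
    and C: "\<And>k. connected (C k)" "\<And>k. C k \<subseteq> X" "\<And>k. c k \<in> C k" "\<And>k. a k \<in> C k"
    and d: "\<And>k. \<delta> \<le> dist (c k) (a k)"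
  obtains L c' a' r where "connected L" "L \<subseteq> X" "c' \<in> L" "a' \<in> L" "\<delta> \<le> dist c' a'"
    "strict_mono (r :: nat \<Rightarrow> nat)" "(c \<circ> r) \<longlonglongrightarrow> c'"
    "\<forall>(h :: 'a \<Rightarrow> 'a) \<epsilon>. continuous_on X h \<longrightarrow>
       (\<forall>\<^sub>F k in sequentially. \<forall>z\<in>C k. dist (h (c k)) (h z) \<le> \<epsilon>) \<longrightarrow> (\<forall>y\<in>L. dist (h c') (h y) \<le> \<epsilon>)"
proof -
  have in_X: "c k \<in> X" "a k \<in> X" for k
    using C(2)[of k] C(3)[of k] C(4)[of k] by auto
  have "compact (X \<times> X)" "\<forall>k. (c k, a k) \<in> X \<times> X"
    using X in_X by (auto intro: compact_Times)
  then obtain p r where p: "p \<in> X \<times> X" and r: "strict_mono (r :: nat \<Rightarrow> nat)"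
    and lim: "((\<lambda>k. (c k, a k)) \<circ> r) \<longlonglongrightarrow> p"
    unfolding compact_def by meson
  obtain c' a' where p_eq: "p = (c', a')" by (cases p)
  have limc: "(\<lambda>k. c (r k)) \<longlonglongrightarrow> c'" and lima: "(\<lambda>k. a (r k)) \<longlonglongrightarrow> a'"
    using tendsto_fst[OF lim] tendsto_snd[OF lim] by (simp_all add: p_eq o_def)
  define L where "L = (\<Inter>n. closure (\<Union>k\<in>{n..}. C (r k)))"
  have "closed X" using X by (simp add: compact_imp_closed)
  have LX: "L \<subseteq> X"
  proof -
    have "closure (\<Union>k\<in>{0..}. C (r k)) \<subseteq> X"
      by (rule closure_minimal) (use C \<open>closed X\<close> in auto)
    then show ?thesis unfolding L_def by blast
  qed
  have "closed L" unfolding L_def by auto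
  with LX X have "compact L"
    by (metis compact_Int_closed inf.absorb2)
  have in_L: "y \<in> L" if zC: "\<And>i. \<exists>k\<ge>i. z i \<in> C (r k)" and zs: "z \<longlonglongrightarrow> y" for z :: "nat \<Rightarrow> 'a" and y
    unfolding L_def
  proof (intro INT_I)
    fix n
    have "\<forall>\<^sub>F i in sequentially. z i \<in> closure (\<Union>k\<in>{n..}. C (r k))"
      using eventually_ge_at_top[of n]
    proof eventually_elim
      case (elim i)
      obtain k where "k \<ge> i" "z i \<in> C (r k)" using zC by blast
      with elim have "z i \<in> (\<Union>k\<in>{n..}. C (r k))" by auto
      then show ?case by (rule subsetD[OF closure_subset])
    qed
    then show "y \<in> closure (\<Union>k\<in>{n..}. C (r k))"
      by (rule Lim_in_closed_set[OF closed_closure _ sequentially_bot zs])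
  qed
  have near: "\<exists>k\<ge>n. \<exists>z\<in>C (r k). dist z y < \<epsilon>" if "y \<in> L" "\<epsilon> > 0" for y n \<epsilon>
  proof -
    have "y \<in> closure (\<Union>k\<in>{n..}. C (r k))" using that unfolding L_def by auto
    with that show ?thesis unfolding closure_approachable by fastforce
  qed
  have c'L: "c' \<in> L" by (rule in_L[OF _ limc]) (use C in auto)
  have a'L: "a' \<in> L" by (rule in_L[OF _ lima]) (use C in auto)
  have dca: "\<delta> \<le> dist c' a'"
    by (rule LIMSEQ_le_const[OF tendsto_dist[OF limc lima]]) (use d in auto)
  have sep: False if A: "compact A" and B: "compact B" and AB: "A \<inter> B = {}" "A \<union> B = L"
    and cA: "c' \<in> A" and "B \<noteq> {}" for A B
  proof -
    obtain U V where UV: "open U" "open V" "A \<subseteq> U" "B \<subseteq> V" "U \<inter> V = {}"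
      using Hausdorff_space_compact_separation[of "euclidean :: 'a topology" A B] A B AB
      by (auto simp: disjnt_def)
    obtain n where n: "\<And>k. k \<ge> n \<Longrightarrow> C (r k) \<subseteq> U \<union> V"
    proof (rule ccontr)
      assume "\<not> thesis"
      with that have "\<forall>n. \<exists>z. (\<exists>k\<ge>n. z \<in> C (r k)) \<and> z \<notin> U \<union> V" by blast
      then obtain z where z: "\<And>n. \<exists>k\<ge>n. z n \<in> C (r k)" "\<And>n. z n \<notin> U \<union> V" by metis
      have "\<forall>n. z n \<in> X" using z C by blast
      with X obtain l s where s: "strict_mono s" "(z \<circ> s) \<longlonglongrightarrow> l"
        unfolding compact_def by meson
      have "l \<in> L"
      proof (rule in_L[OF _ s(2)])
        fix i
        show "\<exists>k\<ge>i. (z \<circ> s) i \<in> C (r k)"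
          using z(1)[of "s i"] seq_suble[OF s(1), of i] by (auto intro: order_trans)
      qed
      moreover have "l \<in> - (U \<union> V)"
        by (rule Lim_in_closed_set[OF _ _ _ s(2)]) (use UV z(2) in auto)
      ultimately show False using AB UV by blast
    qed
    have "\<forall>\<^sub>F k in sequentially. c (r k) \<in> U"
      by (rule topological_tendstoD[OF limc UV(1)]) (use UV cA in auto)
    then obtain m where m: "\<And>k. k \<ge> m \<Longrightarrow> c (r k) \<in> U"
      unfolding eventually_sequentially by blast
    have noV: "C (r k) \<inter> V = {}" if "k \<ge> n" "k \<ge> m" for k
      using connectedD[OF C(1)[of "r k"] UV(1,2)] n[of k] m[of k] that C(3)[of "r k"] UV(5) by blast
    obtain b where b: "b \<in> B" using \<open>B \<noteq> {}\<close> by blast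
    then obtain \<epsilon> where "\<epsilon> > 0" "ball b \<epsilon> \<subseteq> V"
      using UV openE by blast
    moreover obtain k z where "k \<ge> max n m" "z \<in> C (r k)" "dist z b < \<epsilon>"
      using near[of b \<epsilon> "max n m"] b AB \<open>\<epsilon> > 0\<close> by blast
    ultimately show False
      using noV[of k] by (auto simp: subset_iff dist_commute)
  qed
  have "connected L"
    unfolding connected_closed
  proof clarify
    fix A B
    assume AB: "closed A" "closed B" "L \<subseteq> A \<union> B" "A \<inter> B \<inter> L = {}" and ne: "A \<inter> L \<noteq> {}" "B \<inter> L \<noteq> {}"
    have cpt: "compact (L \<inter> A)" "compact (L \<inter> B)"
      using \<open>compact L\<close> AB by (auto intro: compact_Int_closed)
    consider "c' \<in> L \<inter> A" | "c' \<in> L \<inter> B" using c'L AB by blast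
    then show False
    proof cases
      case 1
      show False by (rule sep[OF cpt]) (use AB ne 1 in auto)
    next
      case 2
      show False by (rule sep[OF cpt(2,1)]) (use AB ne 2 in auto)
    qed
  qed
  moreover have "dist (h c') (h y) \<le> \<epsilon>"
    if h: "continuous_on X h" and y: "y \<in> L"
      and ev: "\<forall>\<^sub>F k in sequentially. \<forall>z\<in>C k. dist (h (c k)) (h z) \<le> \<epsilon>" for h :: "'a \<Rightarrow> 'a" and \<epsilon> y
  proof -
    \<comment> \<open>A point of \<open>L\<close> is approached by points \<open>z i\<close> from
      sets of ever later index; the base points at the same indices tend to \<open>c'\<close>, so
      the bound passes to the limit.\<close>
    have "\<forall>i. \<exists>k z. k \<ge> i \<and> z \<in> C (r k) \<and> dist z y < inverse (real (Suc i))"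
      using near[OF y] by (metis inverse_positive_iff_positive of_nat_0_less_iff zero_less_Suc)
    then obtain \<kappa> z where \<kappa>: "\<And>i. \<kappa> i \<ge> i" and z: "\<And>i. z i \<in> C (r (\<kappa> i))"
      and zy: "\<And>i. dist (z i) y < inverse (real (Suc i))" by metis
    have "z \<longlonglongrightarrow> y"
      by (rule metric_tendsto_imp_tendsto[OF LIMSEQ_inverse_real_of_nat])
         (intro always_eventually allI, use less_imp_le[OF zy] in simp)
    have \<kappa>top: "filterlim \<kappa> at_top sequentially"
      by (rule filterlim_at_top_mono[OF filterlim_ident]) (use \<kappa> in auto)
    have c\<kappa>: "(\<lambda>i. c (r (\<kappa> i))) \<longlonglongrightarrow> c'"
      by (rule filterlim_compose[OF limc \<kappa>top])
    have "(\<lambda>i. h (z i)) \<longlonglongrightarrow> h y"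
      by (rule continuous_on_tendsto_compose[OF h \<open>z \<longlonglongrightarrow> y\<close>]) (use y LX subsetD[OF C(2) z] in auto)
    moreover have "(\<lambda>i. h (c (r (\<kappa> i)))) \<longlonglongrightarrow> h c'"
      by (rule continuous_on_tendsto_compose[OF h c\<kappa>]) (use c'L LX in_X in auto)
    ultimately have lim: "(\<lambda>i. dist (h (c (r (\<kappa> i)))) (h (z i))) \<longlonglongrightarrow> dist (h c') (h y)"
      by (intro tendsto_dist)
    have "filterlim (\<lambda>i. r (\<kappa> i)) at_top sequentially"
      by (rule filterlim_compose[OF filterlim_subseq[OF r] \<kappa>top])
    then have "\<forall>\<^sub>F i in sequentially. \<forall>w\<in>C (r (\<kappa> i)). dist (h (c (r (\<kappa> i)))) (h w) \<le> \<epsilon>"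
      by (rule eventually_compose_filterlim[OF ev])
    then have "\<forall>\<^sub>F i in sequentially. dist (h (c (r (\<kappa> i)))) (h (z i)) \<le> \<epsilon>"
      by eventually_elim (use z in auto)
    then show ?thesis
      by (rule tendsto_upperbound[OF lim _ sequentially_bot])
  qed
  ultimately show ?thesis
    using that[of L c' a' r] LX c'L a'L dca r limc by (simp add: o_def)
qed

text \<open>The sets \<open>U z\<close>, whose traces on \<open>X\<close> lie in connected sets of
  radius \<open>r/2\<close>, cover \<open>X\<close>, and a Lebesgue number of the cover is the
  uniform \<open>s\<close>. Halving \<open>r\<close> pays for moving the centre from
  \<open>z\<close> to \<open>x\<close>.\<close>

lemma uniformly_locally_connected:
  fixes X :: "'a::metric_space set"
  assumes "compact X" "locally connected X" "r > 0"
  obtains s where "s > 0" "\<And>x. x \<in> X \<Longrightarrow> ball x s \<inter> X \<subseteq> connected_component_set (X \<inter> cball x r) x"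
proof -
  have "\<exists>U V. open U \<and> connected V \<and> z \<in> U \<and> X \<inter> U \<subseteq> V \<and> V \<subseteq> X \<inter> ball z (r/2)" if "z \<in> X" for z
  proof -
    have "openin (top_of_set X) (X \<inter> ball z (r/2))" "z \<in> X \<inter> ball z (r/2)"
      using that assms by auto
    with \<open>locally connected X\<close> obtain U V where "openin (top_of_set X) U" "connected V"
      "z \<in> U" "U \<subseteq> V" "V \<subseteq> X \<inter> ball z (r/2)"
      unfolding locally_def by meson
    then show ?thesis
      unfolding openin_open by blast
  qed
  then obtain U V where UV: "\<And>z. z \<in> X \<Longrightarrow> open (U z) \<and> connected (V z) \<and> z \<in> U z \<and> X \<inter> U z \<subseteq> V z
      \<and> V z \<subseteq> X \<inter> ball z (r/2)" by metis
  obtain s where s: "s > 0" "\<And>x. x \<in> X \<Longrightarrow> \<exists>G\<in>U ` X. ball x s \<subseteq> G"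
    using Heine_Borel_lemma[OF \<open>compact X\<close>, of "U ` X"] UV by blast
  show thesis
  proof (rule that[OF \<open>s > 0\<close>])
    fix x assume x: "x \<in> X"
    then obtain z where z: "z \<in> X" "ball x s \<subseteq> U z" using s by blast
    have "x \<in> V z" using UV[OF z(1)] z x \<open>s > 0\<close> by (meson IntI centre_in_ball subsetD)
    have "V z \<subseteq> X \<inter> cball x r"
    proof
      fix y assume y: "y \<in> V z"
      have "dist z y < r/2" "dist z x < r/2" "y \<in> X" using y \<open>x \<in> V z\<close> UV[OF z(1)] by auto
      then show "y \<in> X \<inter> cball x r"
        using dist_triangle3[of x y z] by auto
    qed
    then have "V z \<subseteq> connected_component_set (X \<inter> cball x r) x"
      using connected_component_maximal[OF \<open>x \<in> V z\<close>] UV[OF z(1)] by blast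
    then show "ball x s \<inter> X \<subseteq> connected_component_set (X \<inter> cball x r) x"
      using z UV[OF z(1)] by blast
  qed
qed

lemma finite_equicontinuity:
  fixes h :: "nat \<Rightarrow> 'a::metric_space \<Rightarrow> 'b::metric_space"
  assumes "compact X" "\<And>n. continuous_on X (h n)" "\<epsilon> > 0"
  obtains \<delta> where "\<delta> > 0"
    "\<And>n u v. \<lbrakk>n \<le> N; u \<in> X; v \<in> X; dist u v \<le> \<delta>\<rbrakk> \<Longrightarrow> dist (h n u) (h n v) < \<epsilon>"
proof -
  have "\<exists>d>0. \<forall>u\<in>X. \<forall>v\<in>X. dist u v < d \<longrightarrow> dist (h n u) (h n v) < \<epsilon>" for n
    using compact_uniformly_continuous[OF assms(2,1), of n] \<open>\<epsilon> > 0\<close>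
    unfolding uniformly_continuous_on_def by (metis dist_commute)
  then obtain d where d: "\<And>n. d n > 0"
    "\<And>n u v. \<lbrakk>u \<in> X; v \<in> X; dist u v < d n\<rbrakk> \<Longrightarrow> dist (h n u) (h n v) < \<epsilon>" by metis
  define \<delta> where "\<delta> = Min (d ` {..N})"
  have "\<delta> > 0" using d by (auto simp: \<delta>_def)
  have "\<delta> \<le> d n" if "n \<le> N" for n using that by (auto simp: \<delta>_def)
  then show thesis
    using that[of "\<delta>/2"] d(2) \<open>\<delta> > 0\<close> by force
qed

section \<open>Iterates of a homeomorphism and of its inverse\<close>

lemma
  assumes "homeomorphism X X f g"
  shows homeomorphism_funpow_in: "x \<in> X \<Longrightarrow> (f ^^ n) x \<in> X"
    and homeomorphism_funpow_continuous: "continuous_on X (f ^^ n)"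
proof -
  have f: "continuous_on X f" "f ` X = X"
    using assms by (auto simp: homeomorphism_def)
  show in_X: "(f ^^ n) x \<in> X" if "x \<in> X" for x n
    using that f by (induction n) auto
  show "continuous_on X (f ^^ n)"
  proof (induction n)
    case (Suc n)
    have "continuous_on ((f ^^ n) ` X) f"
      using in_X by (intro continuous_on_subset[OF f(1)]) auto
    from continuous_on_compose[OF Suc this] show ?case by simp
  qed (auto intro: continuous_on_id)
qed

lemma funpow_funpow: "(f ^^ m) ((f ^^ n) x) = (f ^^ (m + n)) x"
  by (simp add: funpow_add)

lemma homeomorphism_funpow_inverse:
  assumes "homeomorphism X X f g" "x \<in> X"
  shows "(g ^^ n) ((f ^^ n) x) = x"
proof (induction n)
  case (Suc n)
  have "g (f ((f ^^ n) x)) = (f ^^ n) x"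
    using assms homeomorphism_funpow_in[OF assms(1,2)] by (simp add: homeomorphism_def)
  with Suc show ?case by (simp add: funpow_swap1)
qed simp

lemma homeomorphism_funpow_cancel:
  assumes "homeomorphism X X f g" "x \<in> X" "j \<le> n"
  shows "(g ^^ j) ((f ^^ n) x) = (f ^^ (n - j)) x"
    and "(g ^^ n) ((f ^^ j) x) = (g ^^ (n - j)) x"
proof -
  have "(f ^^ n) x = (f ^^ j) ((f ^^ (n - j)) x)"
    using assms(3) by (metis comp_apply funpow_add le_add_diff_inverse)
  then show "(g ^^ j) ((f ^^ n) x) = (f ^^ (n - j)) x"
    using homeomorphism_funpow_inverse[OF assms(1)] homeomorphism_funpow_in[OF assms(1,2)] by simp
  have "(g ^^ n) ((f ^^ j) x) = (g ^^ (n - j)) ((g ^^ j) ((f ^^ j) x))"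
    using assms(3) by (metis comp_apply funpow_add le_add_diff_inverse2)
  then show "(g ^^ n) ((f ^^ j) x) = (g ^^ (n - j)) x"
    using homeomorphism_funpow_inverse[OF assms(1,2)] by simp
qed


lemma inv_into_funpow_eq:
  assumes "homeomorphism X X f g" "x \<in> X"
  shows "(inv_into X f ^^ n) x = (g ^^ n) x"
proof (induction n)
  case (Suc n)
  have "(g ^^ n) x \<in> X"
    using homeomorphism_funpow_in[OF homeomorphism_symD[OF assms(1)] assms(2)] .
  moreover have "inv_into X f y = g y" if "y \<in> X" for y
    using assms(1) that by (intro inv_into_f_eq) (auto simp: homeomorphism_def intro: inj_on_inverseI)
  ultimately show ?case using Suc by simp
qed simp

section \<open>Sublevel sets and components of balls\<close>

text \<open>Supplies the open set for boundary bumping; finiteness of \<open>I\<close> keeps the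
  intersection open, which is why continua are cut with respect to finitely many times only.\<close>

lemma openin_finite_less:
  fixes \<phi> :: "'i \<Rightarrow> 'a::topological_space \<Rightarrow> real"
  assumes "finite I" "\<And>i. i \<in> I \<Longrightarrow> continuous_on C (\<phi> i)"
  shows "openin (top_of_set C) {z\<in>C. \<forall>i\<in>I. \<phi> i z < a}"
  using assms
proof (induction I)
  case (insert i I)
  have "openin (top_of_set C) (C \<inter> \<phi> i -` {..<a})"
    using insert by (intro continuous_openin_preimage_gen) auto
  then have "openin (top_of_set C) ((C \<inter> \<phi> i -` {..<a}) \<inter> {z\<in>C. \<forall>i\<in>I. \<phi> i z < a})"
    by (rule openin_Int[OF _ insert.IH]) (use insert.prems in auto)
  moreover have "(C \<inter> \<phi> i -` {..<a}) \<inter> {z\<in>C. \<forall>i\<in>I. \<phi> i z < a} = {z\<in>C. \<forall>i\<in>insert i I. \<phi> i z < a}"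
    by auto
  ultimately show ?case by simp
qed simp

lemma closedin_finite_le:
  fixes \<phi> :: "'i \<Rightarrow> 'a::topological_space \<Rightarrow> real"
  assumes "finite I" "\<And>i. i \<in> I \<Longrightarrow> continuous_on C (\<phi> i)"
  shows "closedin (top_of_set C) {z\<in>C. \<forall>i\<in>I. \<phi> i z \<le> a}"
  using assms
proof (induction I)
  case (insert i I)
  have "closedin (top_of_set C) (C \<inter> \<phi> i -` {..a})"
    using insert by (intro continuous_closedin_preimage) auto
  then have "closedin (top_of_set C) ((C \<inter> \<phi> i -` {..a}) \<inter> {z\<in>C. \<forall>i\<in>I. \<phi> i z \<le> a})"
    by (rule closedin_Int[OF _ insert.IH]) (use insert.prems in auto)
  moreover have "(C \<inter> \<phi> i -` {..a}) \<inter> {z\<in>C. \<forall>i\<in>I. \<phi> i z \<le> a} = {z\<in>C. \<forall>i\<in>insert i I. \<phi> i z \<le> a}"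
    by auto
  ultimately show ?case by simp
qed simp

abbreviation iterate_within ::
    "('a::metric_space \<Rightarrow> 'a) \<Rightarrow> nat \<Rightarrow> real \<Rightarrow> 'a \<Rightarrow> 'a set \<Rightarrow> bool" where
  "iterate_within f n r c C \<equiv> \<forall>z\<in>C. dist ((f ^^ n) c) ((f ^^ n) z) \<le> r"

text \<open>A connected substitute for the closed ball: in a locally connected space and for
  positive \<open>r\<close> it is still a neighbourhood of \<open>x\<close> in
  \<open>X\<close>.\<close>

abbreviation ball_component :: "'a::metric_space set \<Rightarrow> 'a \<Rightarrow> real \<Rightarrow> 'a set" where
  "ball_component X x r \<equiv> connected_component_set (X \<inter> cball x r) x"

lemma ball_component_in:
  assumes "x \<in> X" "r \<ge> 0"
  shows "x \<in> ball_component X x r"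
  using assms by (simp add: connected_component_refl)

lemma ball_component_subset: "ball_component X x r \<subseteq> X" "ball_component X x r \<subseteq> cball x r"
  using connected_component_subset[of "X \<inter> cball x r" x] by blast+

lemma compact_ball_component:
  fixes x :: "'a::metric_space"
  assumes "compact X"
  shows "compact (ball_component X x r)"
proof -
  have "compact (X \<inter> cball x r)"
    using assms by (simp add: compact_Int_closed)
  moreover have "closed (ball_component X x r)"
    using calculation by (intro closed_connected_component compact_imp_closed)
  ultimately show ?thesis
    by (metis compact_Int_closed connected_component_subset inf.absorb2)
qed

section \<open>Cw-expansivity made uniform\<close>

text \<open>The inverse \<open>g\<close> is a parameter, which makes the assumptions symmetric in
  \<open>f\<close> and \<open>g\<close>; every result then transfers to the inverse through
  \<open>swap\<close>. Expansivity is put as a radius bound about a base point, the form that limits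
  of connected sets inherit.\<close>

locale cw_expansive_homeomorphism =
  fixes X :: "'a::metric_space set" and f g :: "'a \<Rightarrow> 'a" and e :: real
  assumes cpt: "compact X" and conn: "connected X" and loc_conn: "locally connected X"
    and nontriv: "\<exists>x\<in>X. \<exists>y\<in>X. x \<noteq> y"
    and homeo: "homeomorphism X X f g"
    and e_pos: "e > 0"
    and expansive: "\<lbrakk>connected C; C \<subseteq> X; c \<in> C; \<forall>n. iterate_within f n e c C;
      \<forall>n. iterate_within g n e c C\<rbrakk> \<Longrightarrow> C \<subseteq> {c}"
begin

lemma swap: "cw_expansive_homeomorphism X g f e"
  by unfold_locales
     (use cpt conn loc_conn nontriv homeo e_pos expansive in \<open>auto intro: homeomorphism_symD\<close>)

lemmas f_in = homeomorphism_funpow_in[OF homeo]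
  and g_in = homeomorphism_funpow_in[OF homeomorphism_symD[OF homeo]]
  and f_cont = homeomorphism_funpow_continuous[OF homeo]
  and g_cont = homeomorphism_funpow_continuous[OF homeomorphism_symD[OF homeo]]
  and gf = homeomorphism_funpow_cancel[OF homeo]
  and fg = homeomorphism_funpow_cancel[OF homeomorphism_symD[OF homeo]]
  and g_f_inv = homeomorphism_funpow_inverse[OF homeo]
  and f_g_inv = homeomorphism_funpow_inverse[OF homeomorphism_symD[OF homeo]]

lemma connected_image:
  assumes "connected C" "C \<subseteq> X"
  shows "connected ((f ^^ n) ` C)" "(f ^^ n) ` C \<subseteq> X"
  using assms f_in by (auto intro: connected_continuous_image continuous_on_subset[OF f_cont])

text \<open>Counterexamples for every \<open>N\<close> would have a limit \<open>L\<close> that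
  stays within \<open>e\<close> of its base point at all times in both directions, hence is a single
  point, yet has radius at least \<open>\<eta>\<close>.\<close>

lemma uniform_expansivity:
  assumes "\<eta> > 0"
  obtains N where "\<And>C c y. \<lbrakk>connected C; C \<subseteq> X; c \<in> C; y \<in> C; \<forall>n\<le>N. iterate_within f n e c C;
      \<forall>n\<le>N. iterate_within g n e c C\<rbrakk> \<Longrightarrow> dist c y < \<eta>"
proof (rule ccontr)
  assume contra: "\<not> thesis"
  define bad where "bad N C c y \<longleftrightarrow> connected C \<and> C \<subseteq> X \<and> c \<in> C \<and> y \<in> C \<and>
      (\<forall>n\<le>N. iterate_within f n e c C) \<and> (\<forall>n\<le>N. iterate_within g n e c C) \<and> \<eta> \<le> dist c y" for N C c y
  have "\<exists>C c y. bad N C c y" for N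
  proof (rule ccontr)
    assume nb: "\<nexists>C c y. bad N C c y"
    show False
      by (rule notE[OF contra], rule that[of N], rule ccontr) (insert nb, unfold bad_def not_less, blast)
  qed
  then obtain C c y where bad: "\<And>N. bad N (C N) (c N) (y N)"
    by metis
  have C: "\<And>N. connected (C N)" "\<And>N. C N \<subseteq> X" "\<And>N. c N \<in> C N" "\<And>N. y N \<in> C N"
    and near: "\<And>N n. n \<le> N \<Longrightarrow> iterate_within f n e (c N) (C N)"
      "\<And>N n. n \<le> N \<Longrightarrow> iterate_within g n e (c N) (C N)"
    and far: "\<And>N. \<eta> \<le> dist (c N) (y N)"
    using bad unfolding bad_def by blast+
  obtain L c' y' r where L: "connected L" "L \<subseteq> X" "c' \<in> L" "y' \<in> L" "\<eta> \<le> dist c' y'"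
    and "strict_mono (r :: nat \<Rightarrow> nat)" "(c \<circ> r) \<longlonglongrightarrow> c'"
    and lim: "\<forall>(h :: 'a \<Rightarrow> 'a) \<epsilon>. continuous_on X h \<longrightarrow>
       (\<forall>\<^sub>F k in sequentially. \<forall>z\<in>C k. dist (h (c k)) (h z) \<le> \<epsilon>) \<longrightarrow> (\<forall>y\<in>L. dist (h c') (h y) \<le> \<epsilon>)"
    by (rule limit_continuum[where C = C and c = c and a = y, OF cpt C far], rule that)
  have "\<forall>\<^sub>F k in sequentially. iterate_within f n e (c k) (C k)" for n
    using eventually_ge_at_top[of n] by eventually_elim (rule near)
  then have "\<forall>n. iterate_within f n e c' L"
    using lim f_cont by simp
  moreover have "\<forall>\<^sub>F k in sequentially. iterate_within g n e (c k) (C k)" for n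
    using eventually_ge_at_top[of n] by eventually_elim (rule near)
  then have "\<forall>n. iterate_within g n e c' L"
    using lim g_cont by simp
  ultimately have "y' = c'"
    using expansive[OF L(1,2,3)] L(4) by blast
  with L(5) assms show False by simp
qed

text \<open>For \<open>n \<ge> N\<close> the image of \<open>C\<close> under \<open>f ^^ n\<close>
  is controlled for all forward times and, since its first \<open>n\<close> preimages are earlier
  images of \<open>C\<close>, for \<open>N\<close> backward times; uniform expansivity applies to
  it.\<close>

lemma uniform_contraction:
  assumes "\<eta> > 0"
  obtains N where "\<And>C c y n. \<lbrakk>connected C; C \<subseteq> X; c \<in> C; y \<in> C; \<forall>i. iterate_within f i e c C; n \<ge> N\<rbrakk>
      \<Longrightarrow> dist ((f ^^ n) c) ((f ^^ n) y) < \<eta>"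
proof -
  obtain N where N: "\<And>C c y. \<lbrakk>connected C; C \<subseteq> X; c \<in> C; y \<in> C; \<forall>n\<le>N. iterate_within f n e c C;
      \<forall>n\<le>N. iterate_within g n e c C\<rbrakk> \<Longrightarrow> dist c y < \<eta>"
    using uniform_expansivity[OF assms] by blast
  show thesis
  proof (rule that)
    fix C c y n
    assume C: "connected C" "C \<subseteq> X" "c \<in> C" "y \<in> C" and near: "\<forall>i. iterate_within f i e c C" and n: "n \<ge> N"
    show "dist ((f ^^ n) c) ((f ^^ n) y) < \<eta>"
    proof (rule N[of "(f ^^ n) ` C"])
      show "\<forall>i\<le>N. iterate_within f i e ((f ^^ n) c) ((f ^^ n) ` C)"
        using near by (auto simp: funpow_funpow)
      show "\<forall>i\<le>N. iterate_within g i e ((f ^^ n) c) ((f ^^ n) ` C)"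
        using near C n by (auto simp: gf subset_iff)
    qed (use C connected_image in auto)
  qed
qed

text \<open>If the radius were small at time \<open>n\<close> as well as at time \<open>0\<close>,
  the time \<open>j\<close> of growth would be more than \<open>N\<close> steps away from both ends.
  The image at time \<open>j\<close> would then be controlled for \<open>N\<close> steps each way,
  and uniform expansivity would force its radius below \<open>\<epsilon>\<close>.\<close>

lemma grown_continuum_stays_large:
  assumes "0 < \<epsilon>" "\<epsilon> \<le> e"
  obtains \<delta> where "\<delta> > 0"
    "\<And>C c n j y. \<lbrakk>connected C; C \<subseteq> X; c \<in> C; C \<subseteq> cball c \<delta>; \<forall>i\<le>n. iterate_within f i \<epsilon> c C;
       j \<le> n; y \<in> C; \<epsilon> \<le> dist ((f ^^ j) c) ((f ^^ j) y)\<rbrakk> \<Longrightarrow> \<exists>z\<in>C. \<delta> < dist ((f ^^ n) c) ((f ^^ n) z)"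
proof -
  obtain N where N: "\<And>C c y. \<lbrakk>connected C; C \<subseteq> X; c \<in> C; y \<in> C; \<forall>n\<le>N. iterate_within f n e c C;
      \<forall>n\<le>N. iterate_within g n e c C\<rbrakk> \<Longrightarrow> dist c y < \<epsilon>"
    using uniform_expansivity[OF assms(1)] by blast
  \<comment> \<open>\<open>\<delta>1\<close> rules out growth within \<open>N\<close> steps after
    time \<open>0\<close>, \<open>\<delta>2\<close> growth within \<open>N\<close> steps before time
    \<open>n\<close>.\<close>
  obtain \<delta>1 where \<delta>1: "\<delta>1 > 0"
    "\<And>n u v. \<lbrakk>n \<le> N; u \<in> X; v \<in> X; dist u v \<le> \<delta>1\<rbrakk> \<Longrightarrow> dist ((f ^^ n) u) ((f ^^ n) v) < \<epsilon>"
    using finite_equicontinuity[where h = "\<lambda>n. f ^^ n" and N = N, OF cpt f_cont assms(1)] by blast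
  obtain \<delta>2 where \<delta>2: "\<delta>2 > 0"
    "\<And>n u v. \<lbrakk>n \<le> N; u \<in> X; v \<in> X; dist u v \<le> \<delta>2\<rbrakk> \<Longrightarrow> dist ((g ^^ n) u) ((g ^^ n) v) < \<epsilon>"
    using finite_equicontinuity[where h = "\<lambda>n. g ^^ n" and N = N, OF cpt g_cont assms(1)] by blast
  show thesis
  proof (rule that[of "min \<delta>1 \<delta>2"])
    fix C c n j y
    assume C: "connected C" "C \<subseteq> X" "c \<in> C" "C \<subseteq> cball c (min \<delta>1 \<delta>2)"
      and near: "\<forall>i\<le>n. iterate_within f i \<epsilon> c C" and j: "j \<le> n" and y: "y \<in> C"
      and far: "\<epsilon> \<le> dist ((f ^^ j) c) ((f ^^ j) y)"
    have yc: "y \<in> X" "c \<in> X" using C y by auto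
    show "\<exists>z\<in>C. min \<delta>1 \<delta>2 < dist ((f ^^ n) c) ((f ^^ n) z)"
    proof (rule ccontr)
      assume "\<not> ?thesis"
      then have small: "dist ((f ^^ n) c) ((f ^^ n) y) \<le> \<delta>2" using y by force
      have "dist c y \<le> \<delta>1" using C(4) y by auto
      then have jN: "j > N" using \<delta>1(2)[of j c y] yc far by linarith
      have nN: "n - j > N"
        using \<delta>2(2)[of "n - j" "(f ^^ n) c" "(f ^^ n) y"] yc far small j by (force simp: f_in gf)
      have "dist ((f ^^ j) c) ((f ^^ j) y) < \<epsilon>"
      proof (rule N[of "(f ^^ j) ` C"])
        show "\<forall>i\<le>N. iterate_within f i e ((f ^^ j) c) ((f ^^ j) ` C)"
        proof (intro allI impI ballI)
          fix i z assume "i \<le> N" "z \<in> (f ^^ j) ` C"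
          then obtain w where w: "w \<in> C" "z = (f ^^ j) w" by blast
          have "dist ((f ^^ (i + j)) c) ((f ^^ (i + j)) w) \<le> \<epsilon>"
            using near nN w \<open>i \<le> N\<close> by auto
          then show "dist ((f ^^ i) ((f ^^ j) c)) ((f ^^ i) z) \<le> e"
            using w assms(2) by (simp add: funpow_funpow)
        qed
        show "\<forall>i\<le>N. iterate_within g i e ((f ^^ j) c) ((f ^^ j) ` C)"
        proof (intro allI impI ballI)
          fix i z assume "i \<le> N" "z \<in> (f ^^ j) ` C"
          then obtain w where w: "w \<in> C" "z = (f ^^ j) w" by blast
          have "dist ((f ^^ (j - i)) c) ((f ^^ (j - i)) w) \<le> \<epsilon>" using near j w by auto
          then show "dist ((g ^^ i) ((f ^^ j) c)) ((g ^^ i) z) \<le> e"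
            using w C yc jN \<open>i \<le> N\<close> assms(2) by (auto simp: gf subset_iff)
        qed
      qed (use C y connected_image in auto)
      with far show False by simp
    qed
  qed (use \<delta>1 \<delta>2 in auto)
qed

section \<open>Stable neighbourhoods and the growth of balls\<close>

lemma dist_iterate_continuous:
  assumes "C \<subseteq> X"
  shows "continuous_on C (\<lambda>z. dist a ((f ^^ n) z))"
  by (intro continuous_on_dist continuous_on_const continuous_on_subset[OF f_cont assms])

text \<open>
  If a small continuum at \<open>f\<^sup>-\<^sup>m x\<close> grew, its cut at first growth would be mapped by \<open>f\<^sup>m\<close> to a continuum in
  \<open>D\<close> of definite size that is controlled for all positive times and for \<open>m\<close> negative ones.
\<close>
lemma backward_orbit_stable:
  obtains \<delta> where "\<delta> > 0"
    "\<And>x D \<rho>. \<lbrakk>x \<in> X; \<rho> > 0; ball x \<rho> \<inter> X \<subseteq> D; \<forall>n. iterate_within f n e x D\<rbrakk> \<Longrightarrow>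
       \<exists>M. \<forall>m\<ge>M. \<forall>C. compact C \<and> connected C \<and> C \<subseteq> X \<and> (g ^^ m) x \<in> C \<and> C \<subseteq> cball ((g ^^ m) x) \<delta> \<longrightarrow>
         (\<forall>j. iterate_within f j e ((g ^^ m) x) C)"
proof -
  obtain \<delta> where \<delta>: "\<delta> > 0"
    "\<And>C c n j y. \<lbrakk>connected C; C \<subseteq> X; c \<in> C; C \<subseteq> cball c \<delta>; \<forall>i\<le>n. iterate_within f i e c C;
       j \<le> n; y \<in> C; e \<le> dist ((f ^^ j) c) ((f ^^ j) y)\<rbrakk> \<Longrightarrow> \<exists>z\<in>C. \<delta> < dist ((f ^^ n) c) ((f ^^ n) z)"
    using grown_continuum_stays_large[OF e_pos order_refl] by metis
  show thesis
  proof (rule that[OF \<delta>(1)])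
    fix x D \<rho>
    assume x: "x \<in> X" and \<rho>: "\<rho> > 0" and D: "ball x \<rho> \<inter> X \<subseteq> D"
      and D_near: "\<forall>n. iterate_within f n e x D"
    \<comment> \<open>The bound \<open>\<rho>/2\<close> keeps points within \<open>d\<close> of
      \<open>x\<close> inside \<open>D\<close>; the bound \<open>\<delta>\<close> makes any radius
      beyond \<open>\<delta>\<close> exceed \<open>d\<close>.\<close>
    define d where "d = min (\<rho>/2) \<delta>"
    have d: "d > 0" "d < \<rho>" "d \<le> \<delta>" using \<rho> \<delta>(1) by (auto simp: d_def)
    obtain M where M: "\<And>C c y. \<lbrakk>connected C; C \<subseteq> X; c \<in> C; y \<in> C; \<forall>n\<le>M. iterate_within f n e c C;
        \<forall>n\<le>M. iterate_within g n e c C\<rbrakk> \<Longrightarrow> dist c y < d"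
      using uniform_expansivity[OF d(1)] by blast
    have "iterate_within f j e ((g ^^ m) x) C"
      if m: "m \<ge> M" and C: "compact C" "connected C" "C \<subseteq> X" "(g ^^ m) x \<in> C" "C \<subseteq> cball ((g ^^ m) x) \<delta>"
      for m C j
    proof -
      define c where "c = (g ^^ m) x"
      have c: "c \<in> C" "c \<in> X" "(f ^^ m) c = x" using C x by (auto simp: c_def f_g_inv)
      \<comment> \<open>Leaving \<open>W\<close> means either growing to \<open>e\<close> at some
        time up to \<open>m\<close> or reaching distance \<open>d\<close> from \<open>x\<close> at
        time \<open>m\<close>. The second condition keeps the image of the cut inside
        \<open>D\<close>.\<close>
      define W where "W = {z\<in>C. \<forall>i\<in>{..m}. dist ((f ^^ i) c) ((f ^^ i) z) < e} \<inter> {z\<in>C. \<forall>i\<in>{m}. dist x ((f ^^ i) z) < d}"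
      define F where "F = {z\<in>C. \<forall>i\<in>{..m}. dist ((f ^^ i) c) ((f ^^ i) z) \<le> e} \<inter> {z\<in>C. \<forall>i\<in>{m}. dist x ((f ^^ i) z) \<le> d}"
      have W: "openin (top_of_set C) W"
        unfolding W_def by (intro openin_Int openin_finite_less dist_iterate_continuous C) auto
      have F: "closedin (top_of_set C) F"
        unfolding F_def by (intro closedin_Int closedin_finite_le dist_iterate_continuous C) auto
      have in_D: "(f ^^ m) z \<in> D" if "z \<in> X" "dist x ((f ^^ m) z) \<le> d" for z
        using that d D f_in by (auto simp: subset_iff)
      have "C \<subseteq> W"
      proof (rule ccontr)
        assume "\<not> C \<subseteq> W"
        moreover have "W \<subseteq> F" "c \<in> W" using c d e_pos by (auto simp: W_def F_def less_imp_le)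
        ultimately obtain T where T: "connected T" "c \<in> T" "T \<subseteq> F" "\<not> T \<subseteq> W"
          using boundary_bumping_neighbourhood[OF C(1,2) F W] by metis
        have TC: "T \<subseteq> C" "T \<subseteq> X" using T(3) C by (auto simp: F_def)
        have T_cball: "T \<subseteq> cball c \<delta>" using TC(1) C(5) by (simp add: c_def)
        have T_near: "\<forall>i\<le>m. iterate_within f i e c T" using T(3) by (auto simp: F_def)
        obtain z where z: "z \<in> T" "z \<notin> W" using T by blast
        \<comment> \<open>Both ways of leaving \<open>W\<close> end alike: growth at an earlier time
          persists as a radius above \<open>\<delta> \<ge> d\<close> at time
          \<open>m\<close>.\<close>
        have "\<exists>w\<in>T. d \<le> dist x ((f ^^ m) w)"
        proof (cases "d \<le> dist x ((f ^^ m) z)")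
          case False
          then obtain i where i: "i \<le> m" "e \<le> dist ((f ^^ i) c) ((f ^^ i) z)"
            using z TC by (force simp: W_def not_less)
          then obtain w where "w \<in> T" "\<delta> < dist ((f ^^ m) c) ((f ^^ m) w)"
            using \<delta>(2)[OF T(1) TC(2) T(2) T_cball T_near i(1) z(1) i(2)] by blast
          then show ?thesis using c d by force
        qed (use z in auto)
        then obtain w where w: "w \<in> T" "d \<le> dist x ((f ^^ m) w)" by blast
        have "dist x ((f ^^ m) w) < d"
        proof (rule M[of "(f ^^ m) ` T"])
          show "\<forall>n\<le>M. iterate_within f n e x ((f ^^ m) ` T)"
            using in_D D_near T(3) TC by (auto simp: F_def subset_iff)
          show "\<forall>n\<le>M. iterate_within g n e x ((f ^^ m) ` T)"
          proof (intro allI impI ballI)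
            fix n y assume "n \<le> M" "y \<in> (f ^^ m) ` T"
            then obtain v where v: "v \<in> T" "y = (f ^^ m) v" by blast
            have "dist ((f ^^ (m - n)) c) ((f ^^ (m - n)) v) \<le> e" using T_near v by auto
            moreover have "(g ^^ n) x = (f ^^ (m - n)) c" "(g ^^ n) y = (f ^^ (m - n)) v"
              using gf(1)[OF c(2), of n m] gf(1)[of v n m] \<open>n \<le> M\<close> m c(3) v TC by auto
            ultimately show "dist ((g ^^ n) x) ((g ^^ n) y) \<le> e" by simp
          qed
        qed (use T TC w c connected_image in \<open>auto intro: image_eqI[of _ _ c]\<close>)
        with w show False by simp
      qed
      have "dist ((f ^^ j) c) ((f ^^ j) z) \<le> e" if z: "z \<in> C" for z
      proof (cases "j \<le> m")
        case True
        then show ?thesis using z \<open>C \<subseteq> W\<close> by (force simp: W_def)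
      next
        case False
        then have split: "(f ^^ j) u = (f ^^ (j - m)) ((f ^^ m) u)" for u
          by (metis comp_apply funpow_add le_add_diff_inverse2 nat_le_linear)
        have "(f ^^ m) z \<in> D"
          using z \<open>C \<subseteq> W\<close> C by (intro in_D) (auto simp: W_def subset_iff intro: less_imp_le)
        then show ?thesis using D_near c by (simp add: split)
      qed
      then show ?thesis by (simp add: c_def)
    qed
    then show "\<exists>M. \<forall>m\<ge>M. \<forall>C. compact C \<and> connected C \<and> C \<subseteq> X \<and> (g ^^ m) x \<in> C \<and>
        C \<subseteq> cball ((g ^^ m) x) \<delta> \<longrightarrow> (\<forall>j. iterate_within f j e ((g ^^ m) x) C)"
      by blast
  qed
qed

text \<open>Two points \<open>x\<close> and \<open>y\<close> of \<open>D\<close> return near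
  themselves at a common time \<open>p\<close>, although contraction brings their images at time
  \<open>p\<close> together; this makes \<open>dist x y\<close> less than itself. The bound is
  \<open>e/2\<close> so that it becomes \<open>e\<close> when the base point moves from
  \<open>x\<close> to \<open>y\<close>.\<close>

lemma no_stable_neighbourhood:
  assumes x: "x \<in> X" and \<rho>: "\<rho> > 0" and D: "ball x \<rho> \<inter> X \<subseteq> D" "D \<subseteq> X" "connected D"
    and near: "\<forall>n. iterate_within f n (e/2) x D"
  shows False
proof -
  have "X \<noteq> {x}" using nontriv by blast
  then have "x islimpt X"
    using conn x by (intro connected_imp_perfect) auto
  then obtain y where y: "y \<in> X" "y \<noteq> x" "dist x y < \<rho>"
    using \<rho> unfolding islimpt_approachable by (metis dist_commute)
  have xD: "x \<in> D" and yD: "y \<in> D" using D(1) x y \<rho> by auto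
  have near_x: "\<forall>n. iterate_within f n e x D"
  proof (intro allI ballI)
    fix n z assume "z \<in> D"
    then have "dist ((f ^^ n) x) ((f ^^ n) z) \<le> e/2" using near by blast
    then show "dist ((f ^^ n) x) ((f ^^ n) z) \<le> e" using e_pos by linarith
  qed
  have near_y: "\<forall>n. iterate_within f n e y D"
  proof (intro allI ballI)
    fix n z assume "z \<in> D"
    then have "dist ((f ^^ n) x) ((f ^^ n) z) \<le> e/2" "dist ((f ^^ n) x) ((f ^^ n) y) \<le> e/2"
      using near yD by auto
    then show "dist ((f ^^ n) y) ((f ^^ n) z) \<le> e"
      using dist_triangle3[of "(f ^^ n) y" "(f ^^ n) z" "(f ^^ n) x"] by linarith
  qed
  have D_y: "ball y (\<rho> - dist x y) \<inter> X \<subseteq> D"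
  proof
    fix z assume "z \<in> ball y (\<rho> - dist x y) \<inter> X"
    then show "z \<in> D" using D(1) dist_triangle[of x z y] by (auto simp: subset_iff)
  qed
  \<comment> \<open>This \<open>\<delta>\<close> does not depend on the point, so one
    \<open>s\<close> serves for returns to \<open>x\<close> and to \<open>y\<close>.\<close>
  obtain \<delta> where \<delta>: "\<delta> > 0"
    "\<And>x D \<rho>. \<lbrakk>x \<in> X; \<rho> > 0; ball x \<rho> \<inter> X \<subseteq> D; \<forall>n. iterate_within f n e x D\<rbrakk> \<Longrightarrow>
       \<exists>M. \<forall>m\<ge>M. \<forall>C. compact C \<and> connected C \<and> C \<subseteq> X \<and> (g ^^ m) x \<in> C \<and> C \<subseteq> cball ((g ^^ m) x) \<delta> \<longrightarrow>
         (\<forall>j. iterate_within f j e ((g ^^ m) x) C)"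
    using backward_orbit_stable by metis
  obtain s where s: "s > 0" "\<And>x. x \<in> X \<Longrightarrow> ball x s \<inter> X \<subseteq> ball_component X x \<delta>"
    using uniformly_locally_connected[OF cpt loc_conn \<delta>(1)] by blast
  define \<eta> where "\<eta> = dist x y / 3"
  have \<eta>: "\<eta> > 0" using y by (simp add: \<eta>_def)
  obtain N where N: "\<And>C c y n. \<lbrakk>connected C; C \<subseteq> X; c \<in> C; y \<in> C; \<forall>i. iterate_within f i e c C; n \<ge> N\<rbrakk>
      \<Longrightarrow> dist ((f ^^ n) c) ((f ^^ n) y) < \<eta>"
    using uniform_contraction[OF \<eta>] by blast
  \<comment> \<open>A point \<open>w\<close> near \<open>(g ^^ m) u\<close> lies in a small
    continuum through it that is controlled at all forward times; by time \<open>m\<close> this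
    continuum has contracted around \<open>u\<close>.\<close>
  have return: "\<exists>M. \<forall>m\<ge>M. \<forall>w\<in>X. dist ((g ^^ m) u) w < s \<longrightarrow> dist u ((f ^^ m) w) < \<eta>"
    if u: "u \<in> X" "r > 0" "ball u r \<inter> X \<subseteq> D" "\<forall>n. iterate_within f n e u D" for u r
  proof -
    obtain M where M: "\<forall>m\<ge>M. \<forall>C. compact C \<and> connected C \<and> C \<subseteq> X \<and> (g ^^ m) u \<in> C \<and>
        C \<subseteq> cball ((g ^^ m) u) \<delta> \<longrightarrow> (\<forall>j. iterate_within f j e ((g ^^ m) u) C)"
      using \<delta>(2)[OF u] by (elim exE)
    have "dist u ((f ^^ m) w) < \<eta>" if m: "m \<ge> max M N" and w: "w \<in> X" "dist ((g ^^ m) u) w < s" for m w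
    proof -
      let ?K = "ball_component X ((g ^^ m) u) \<delta>"
      have gu: "(g ^^ m) u \<in> X" using g_in[OF u(1)] .
      have K: "compact ?K" "connected ?K" "?K \<subseteq> X" "(g ^^ m) u \<in> ?K" "?K \<subseteq> cball ((g ^^ m) u) \<delta>"
        by (rule compact_ball_component[OF cpt] connected_connected_component ball_component_subset
            ball_component_in[OF gu less_imp_le[OF \<delta>(1)]])+
      have "w \<in> ?K" using s(2)[OF gu] w by auto
      moreover have "\<forall>j. iterate_within f j e ((g ^^ m) u) ?K"
        using m K by (intro M[THEN spec, THEN mp, THEN spec, THEN mp]) simp_all
      ultimately have "dist ((f ^^ m) ((g ^^ m) u)) ((f ^^ m) w) < \<eta>"
        using m by (intro N[OF K(2,3,4)]) simp_all
      then show ?thesis using f_g_inv[OF u(1)] by simp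
    qed
    then show ?thesis by blast
  qed
  obtain Mx where Mx: "\<And>m w. \<lbrakk>m \<ge> Mx; w \<in> X; dist ((g ^^ m) x) w < s\<rbrakk> \<Longrightarrow> dist x ((f ^^ m) w) < \<eta>"
    using return[OF x \<rho> D(1) near_x] by blast
  obtain My where My: "\<And>m w. \<lbrakk>m \<ge> My; w \<in> X; dist ((g ^^ m) y) w < s\<rbrakk> \<Longrightarrow> dist y ((f ^^ m) w) < \<eta>"
    using return[OF y(1) _ D_y near_y] y(3) by auto
  have "compact (X \<times> X)" "\<forall>k. ((g ^^ k) x, (g ^^ k) y) \<in> X \<times> X"
    using cpt g_in x y by (auto intro: compact_Times)
  then obtain p r where r: "strict_mono (r :: nat \<Rightarrow> nat)"
    and "((\<lambda>k. ((g ^^ k) x, (g ^^ k) y)) \<circ> r) \<longlonglongrightarrow> p"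
    unfolding compact_def by meson
  then have "Cauchy ((\<lambda>k. ((g ^^ k) x, (g ^^ k) y)) \<circ> r)"
    by (intro LIMSEQ_imp_Cauchy)
  then obtain j where j: "\<And>k. k \<ge> j \<Longrightarrow>
      dist ((g ^^ r k) x, (g ^^ r k) y) ((g ^^ r j) x, (g ^^ r j) y) < s"
    using s(1) unfolding Cauchy_def by force
  \<comment> \<open>The summand \<open>r j + N\<close> makes the common return time
    \<open>r k - r j\<close> at least \<open>N\<close>, as contraction requires; the others meet the
    Cauchy estimate and the two return thresholds.\<close>
  define k where "k = j + r j + N + Mx + My"
  have "r k \<ge> k" using r by (rule seq_suble)
  then have k: "k \<ge> j" "r k \<ge> Mx" "r k \<ge> My" "r k - r j \<ge> N" "r j \<le> r k" by (auto simp: k_def)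
  have close: "dist ((g ^^ r k) x) ((g ^^ r j) x) < s" "dist ((g ^^ r k) y) ((g ^^ r j) y) < s"
    using le_less_trans[OF dist_fst_le j[OF k(1)]] le_less_trans[OF dist_snd_le j[OF k(1)]] by simp_all
  \<comment> \<open>Here the point \<open>w\<close> is the earlier backward iterate
    \<open>(g ^^ r j) x\<close>, which \<open>f ^^ r k\<close> carries to the forward iterate of
    \<open>x\<close> at time \<open>r k - r j\<close>.\<close>
  have "dist x ((f ^^ (r k - r j)) x) < \<eta>"
    using Mx[OF k(2) g_in[OF x] close(1)] fg(2)[OF x k(5)] by simp
  moreover have "dist y ((f ^^ (r k - r j)) y) < \<eta>"
    using My[OF k(3) g_in[OF y(1)] close(2)] fg(2)[OF y(1) k(5)] by simp
  moreover have "dist ((f ^^ (r k - r j)) x) ((f ^^ (r k - r j)) y) < \<eta>"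
    by (rule N[OF D(3,2) xD yD near_x k(4)])
  ultimately have "dist x y < 3 * \<eta>"
    using dist_triangle[of x y "(f ^^ (r k - r j)) x"]
      dist_triangle2[of "(f ^^ (r k - r j)) x" y "(f ^^ (r k - r j)) y"] by linarith
  then show False by (simp add: \<eta>_def)
qed

text \<open>Centres that violate the claim for every \<open>N\<close> accumulate at some
  \<open>l\<close>. A fixed neighbourhood of \<open>l\<close> lies in the late components, so it is
  controlled at all times, which is impossible. Moving the base point to \<open>l\<close> doubles
  \<open>e/4\<close> to the \<open>e/2\<close> excluded before.\<close>

lemma ball_component_grows:
  assumes "\<gamma> > 0"
  obtains N where "\<And>x. x \<in> X \<Longrightarrow> \<exists>n\<le>N. \<not> iterate_within f n (e/4) x (ball_component X x \<gamma>)"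
proof (rule ccontr)
  assume "\<not> thesis"
  with that have "\<forall>N. \<exists>x. x \<in> X \<and> (\<forall>n\<le>N. iterate_within f n (e/4) x (ball_component X x \<gamma>))"
    by blast
  then obtain x where x: "\<And>N. x N \<in> X"
    and near: "\<And>N n. n \<le> N \<Longrightarrow> iterate_within f n (e/4) (x N) (ball_component X (x N) \<gamma>)"
    by metis
  obtain l r where l: "l \<in> X" and r: "strict_mono (r :: nat \<Rightarrow> nat)" "(x \<circ> r) \<longlonglongrightarrow> l"
    using cpt x unfolding compact_def by meson
  obtain s where s: "s > 0" "\<And>x. x \<in> X \<Longrightarrow> ball x s \<inter> X \<subseteq> ball_component X x \<gamma>"
    using uniformly_locally_connected[OF cpt loc_conn assms] by blast
  have s3: "s/3 > 0" using s by simp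
  \<comment> \<open>The component around \<open>l\<close> must itself contain a ball about
    \<open>l\<close>, hence the second use of uniform local connectedness.\<close>
  obtain t where t: "t > 0" "\<And>x. x \<in> X \<Longrightarrow> ball x t \<inter> X \<subseteq> ball_component X x (s/3)"
    using uniformly_locally_connected[OF cpt loc_conn s3] by blast
  let ?D = "ball_component X l (s/3)"
  have lD: "l \<in> ?D" using l s by (auto intro: ball_component_in)
  have "\<forall>n. iterate_within f n (e/2) l ?D"
  proof (intro allI ballI)
    fix n z assume z: "z \<in> ?D"
    have "\<forall>\<^sub>F k in sequentially. dist ((x \<circ> r) k) l < s/3"
      using r(2) s3 by (rule tendstoD)
    then have "\<forall>\<^sub>F k in sequentially. dist ((x \<circ> r) k) l < s/3 \<and> n \<le> k"
      using eventually_ge_at_top[of n] by (rule eventually_conj)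
    then obtain k where k: "dist (x (r k)) l < s/3" "n \<le> k"
      by (auto dest: eventually_happens)
    \<comment> \<open>Two distances of at most \<open>s/3\<close> add up to less than
      \<open>s\<close>.\<close>
    have "?D \<subseteq> ball_component X (x (r k)) \<gamma>"
    proof
      fix w assume w: "w \<in> ?D"
      then have "w \<in> X" "dist l w \<le> s/3" using ball_component_subset by fastforce+
      then have "w \<in> ball (x (r k)) s \<inter> X"
        using k s3 dist_triangle[of "x (r k)" w l] by auto
      then show "w \<in> ball_component X (x (r k)) \<gamma>" using s(2)[OF x] by blast
    qed
    moreover have "n \<le> r k" using k(2) seq_suble[OF r(1), of k] by simp
    ultimately have "dist ((f ^^ n) (x (r k))) ((f ^^ n) l) \<le> e/4" "dist ((f ^^ n) (x (r k))) ((f ^^ n) z) \<le> e/4"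
      using near[of n "r k"] lD z by blast+
    then show "dist ((f ^^ n) l) ((f ^^ n) z) \<le> e/2"
      using dist_triangle3[of "(f ^^ n) l" "(f ^^ n) z" "(f ^^ n) (x (r k))"] by linarith
  qed
  then show False
    using no_stable_neighbourhood[OF l t(1) t(2)[OF l] ball_component_subset(1) connected_connected_component]
    by blast
qed

section \<open>Stable continua of definite size\<close>

text \<open>The growth results are used for \<open>g\<close> at \<open>c = (f ^^ n) x\<close>: times
  \<open>0\<close> to \<open>n\<close> of \<open>g\<close> from \<open>c\<close> are times
  \<open>n\<close> to \<open>0\<close> of \<open>f\<close> from \<open>x\<close>. Control of the cut
  under \<open>g\<close> is therefore control of its image at \<open>x\<close> under
  \<open>f\<close>.\<close>

lemma stable_continuum:
  assumes "\<epsilon> > 0"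
  obtains \<delta> where "\<delta> > 0"
    "\<And>x. x \<in> X \<Longrightarrow> \<exists>L. connected L \<and> L \<subseteq> X \<and> x \<in> L \<and> (\<exists>y\<in>L. \<delta> \<le> dist x y) \<and>
       (\<forall>n. iterate_within f n \<epsilon> x L)"
proof -
  interpret S: cw_expansive_homeomorphism X g f e by (rule swap)
  \<comment> \<open>Below \<open>e/4\<close>, so that a component that grows past \<open>e/4\<close>
    certainly reaches \<open>\<epsilon>'\<close>.\<close>
  define \<epsilon>' where "\<epsilon>' = min \<epsilon> (e/4)"
  have \<epsilon>': "\<epsilon>' > 0" "\<epsilon>' \<le> e" "\<epsilon>' \<le> \<epsilon>" "\<epsilon>' \<le> e/4" using assms e_pos by (auto simp: \<epsilon>'_def)
  obtain \<delta> where \<delta>: "\<delta> > 0"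
    "\<And>C c n j y. \<lbrakk>connected C; C \<subseteq> X; c \<in> C; C \<subseteq> cball c \<delta>; \<forall>i\<le>n. iterate_within g i \<epsilon>' c C;
       j \<le> n; y \<in> C; \<epsilon>' \<le> dist ((g ^^ j) c) ((g ^^ j) y)\<rbrakk> \<Longrightarrow> \<exists>z\<in>C. \<delta> < dist ((g ^^ n) c) ((g ^^ n) z)"
    using S.grown_continuum_stays_large[OF \<epsilon>'(1,2)] by metis
  obtain N where N: "\<And>x. x \<in> X \<Longrightarrow> \<exists>n\<le>N. \<not> iterate_within g n (e/4) x (ball_component X x \<delta>)"
    using S.ball_component_grows[OF \<delta>(1)] by blast
  have step: "\<exists>A a. connected A \<and> A \<subseteq> X \<and> x \<in> A \<and> a \<in> A \<and> \<delta> \<le> dist x a \<and>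
      (\<forall>i\<le>n. iterate_within f i \<epsilon>' x A)" if x: "x \<in> X" and n: "n \<ge> N" for x n
  proof -
    define c where "c = (f ^^ n) x"
    have c: "c \<in> X" "(g ^^ n) c = x" using x f_in g_f_inv by (auto simp: c_def)
    let ?K = "ball_component X c \<delta>"
    have K: "compact ?K" "connected ?K" "?K \<subseteq> X" "c \<in> ?K" "?K \<subseteq> cball c \<delta>"
      by (rule compact_ball_component[OF cpt] connected_connected_component ball_component_subset
          ball_component_in[OF c(1) less_imp_le[OF \<delta>(1)]])+
    define W where "W = {z\<in>?K. \<forall>i\<in>{..n}. dist ((g ^^ i) c) ((g ^^ i) z) < \<epsilon>'}"
    define F where "F = {z\<in>?K. \<forall>i\<in>{..n}. dist ((g ^^ i) c) ((g ^^ i) z) \<le> \<epsilon>'}"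
    have W: "openin (top_of_set ?K) W"
      unfolding W_def by (intro openin_finite_less S.dist_iterate_continuous K) auto
    have F: "closedin (top_of_set ?K) F"
      unfolding F_def by (intro closedin_finite_le S.dist_iterate_continuous K) auto
    have WF: "W \<subseteq> F" "c \<in> W" using K \<epsilon>' by (auto simp: W_def F_def less_imp_le)
    have "\<not> ?K \<subseteq> W"
    proof
      assume sub: "?K \<subseteq> W"
      obtain i z where "i \<le> N" "z \<in> ?K" "\<not> dist ((g ^^ i) c) ((g ^^ i) z) \<le> e/4"
        using N[OF c(1)] by blast
      moreover have "dist ((g ^^ i) c) ((g ^^ i) z) < \<epsilon>'"
        using sub calculation(1,2) n by (auto simp: W_def)
      ultimately show False using \<epsilon>' by linarith
    qed
    then obtain T where T: "connected T" "c \<in> T" "T \<subseteq> F" "\<not> T \<subseteq> W"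
      using boundary_bumping_neighbourhood[OF K(1,2) F W WF] by metis
    have TK: "T \<subseteq> X" "T \<subseteq> cball c \<delta>" using T(3) K(3,5) by (auto simp: F_def)
    have T_near: "\<forall>i\<le>n. iterate_within g i \<epsilon>' c T" using T(3) by (auto simp: F_def)
    obtain z where z: "z \<in> T" "z \<notin> W" using T by blast
    then obtain i where i: "i \<le> n" "\<epsilon>' \<le> dist ((g ^^ i) c) ((g ^^ i) z)"
      using T(3) by (auto simp: W_def F_def not_less)
    \<comment> \<open>The cut reaches \<open>\<epsilon>'\<close> at some time
      \<open>i \<le> n\<close>; it is therefore still larger than \<open>\<delta>\<close> at time
      \<open>n\<close>, when it has arrived at \<open>x\<close>.\<close>
    obtain w where w: "w \<in> T" "\<delta> < dist ((g ^^ n) c) ((g ^^ n) w)"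
      using \<delta>(2)[OF T(1) TK(1) T(2) TK(2) T_near i(1) z(1) i(2)] by blast
    have "iterate_within f i \<epsilon>' x ((g ^^ n) ` T)" if "i \<le> n" for i
    proof
      fix v assume "v \<in> (g ^^ n) ` T"
      then obtain u where u: "u \<in> T" "v = (g ^^ n) u" by blast
      have "(f ^^ i) x = (g ^^ (n - i)) c" "(f ^^ i) v = (g ^^ (n - i)) u"
        using fg(1)[OF c(1) that] fg(1)[of u i n] that c(2) u TK by auto
      then show "dist ((f ^^ i) x) ((f ^^ i) v) \<le> \<epsilon>'" using T_near u by simp
    qed
    moreover have "x \<in> (g ^^ n) ` T" using c(2) T(2) by blast
    ultimately show ?thesis
      using S.connected_image[OF T(1) TK(1), of n] w c(2)
      by (intro exI[of _ "(g ^^ n) ` T"] exI[of _ "(g ^^ n) w"]) auto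
  qed
  show thesis
  proof (rule that[OF \<delta>(1)])
    fix x assume x: "x \<in> X"
    \<comment> \<open>Indexing by \<open>N + k\<close> makes the construction available for every
      \<open>k\<close>; all base points equal \<open>x\<close>, so the limit has base point
      \<open>x\<close> too.\<close>
    have "\<forall>k. \<exists>A a. connected A \<and> A \<subseteq> X \<and> x \<in> A \<and> a \<in> A \<and> \<delta> \<le> dist x a \<and>
      (\<forall>i\<le>N + k. iterate_within f i \<epsilon>' x A)"
      using step[OF x] by simp
    then obtain A a where A: "\<And>k. connected (A k)" "\<And>k. A k \<subseteq> X" "\<And>k. x \<in> A k" "\<And>k. a k \<in> A k"
      and far: "\<And>k. \<delta> \<le> dist x (a k)"
      and near: "\<And>k i. i \<le> N + k \<Longrightarrow> iterate_within f i \<epsilon>' x (A k)"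
      by metis
    obtain L c' a' r where L: "connected L" "L \<subseteq> X" "c' \<in> L" "a' \<in> L" "\<delta> \<le> dist c' a'"
      and "strict_mono (r :: nat \<Rightarrow> nat)" and c': "((\<lambda>_. x) \<circ> r) \<longlonglongrightarrow> c'"
      and lim: "\<forall>(h :: 'a \<Rightarrow> 'a) \<epsilon>. continuous_on X h \<longrightarrow>
        (\<forall>\<^sub>F k in sequentially. \<forall>z\<in>A k. dist (h x) (h z) \<le> \<epsilon>) \<longrightarrow> (\<forall>y\<in>L. dist (h c') (h y) \<le> \<epsilon>)"
      by (rule limit_continuum[where C = A and c = "\<lambda>_. x" and a = a, OF cpt A far], rule that)
    have "c' = x" using c' by (simp add: o_def LIMSEQ_const_iff)
    have "iterate_within f n \<epsilon> x L" for n
    proof -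
      have "\<forall>\<^sub>F k in sequentially. iterate_within f n \<epsilon>' x (A k)"
        using eventually_ge_at_top[of n] by eventually_elim (rule near, simp)
      then have "iterate_within f n \<epsilon>' x L"
        using lim f_cont \<open>c' = x\<close> by simp
      then show ?thesis using \<epsilon>'(3) by (meson order_trans)
    qed
    then show "\<exists>L. connected L \<and> L \<subseteq> X \<and> x \<in> L \<and> (\<exists>y\<in>L. \<delta> \<le> dist x y) \<and>
       (\<forall>n. iterate_within f n \<epsilon> x L)"
      using L \<open>c' = x\<close> by blast
  qed
qed

lemma component_diameter_ge:
  assumes "\<epsilon> > 0"
  obtains \<delta> where "\<delta> > 0"
    "\<And>x. x \<in> X \<Longrightarrow>
       \<delta> \<le> diameter (connected_component_set {y\<in>X. \<forall>n. dist ((f ^^ n) x) ((f ^^ n) y) \<le> \<epsilon>} x)"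
proof -
  obtain \<delta> where \<delta>: "\<delta> > 0"
    "\<And>x. x \<in> X \<Longrightarrow> \<exists>L. connected L \<and> L \<subseteq> X \<and> x \<in> L \<and> (\<exists>y\<in>L. \<delta> \<le> dist x y) \<and>
       (\<forall>n. iterate_within f n \<epsilon> x L)"
    using stable_continuum[OF assms] by metis
  show thesis
  proof (rule that[OF \<delta>(1)])
    fix x assume "x \<in> X"
    let ?W = "{y\<in>X. \<forall>n. dist ((f ^^ n) x) ((f ^^ n) y) \<le> \<epsilon>}"
    obtain L y where L: "connected L" "L \<subseteq> X" "x \<in> L" "y \<in> L" "\<delta> \<le> dist x y"
      "\<forall>n. iterate_within f n \<epsilon> x L"
      using \<delta>(2)[OF \<open>x \<in> X\<close>] by blast
    have "L \<subseteq> ?W" using L(2,6) by auto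
    with L(3,1) have sub: "L \<subseteq> connected_component_set ?W x"
      by (rule connected_component_maximal)
    \<comment> \<open>\<open>diameter\<close> is a real supremum and dominates distances only on
      bounded sets.\<close>
    have "connected_component_set ?W x \<subseteq> X"
      using connected_component_subset[of ?W x] by blast
    then have "bounded (connected_component_set ?W x)"
      by (rule bounded_subset[OF compact_imp_bounded[OF cpt]])
    then have "dist x y \<le> diameter (connected_component_set ?W x)"
      using sub L by (intro diameter_bounded_bound) auto
    then show "\<delta> \<le> diameter (connected_component_set ?W x)" using L(5) by linarith
  qed
qed

end

section \<open>Translation between radii and diameters, and the two bounds\<close>

lemma diameter_le_twice_radius:
  fixes S :: "'a::metric_space set"
  assumes "\<And>z. z \<in> S \<Longrightarrow> dist c z \<le> r" "0 \<le> r"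
  shows "diameter S \<le> 2 * r"
proof (cases "S = {}")
  case False
  have "dist u v \<le> 2 * r" if "u \<in> S" "v \<in> S" for u v
    using dist_triangle3[of u v c] assms(1)[OF that(1)] assms(1)[OF that(2)] by linarith
  with False show ?thesis
    unfolding diameter_def by (auto intro!: cSUP_least)
qed (use assms in simp)

text \<open>With \<open>e = \<alpha>/2\<close>, radii of at most \<open>e\<close> at all times give
  diameters of at most \<open>\<alpha>\<close>, so the supremum cannot exceed
  \<open>\<alpha>\<close> and the set is degenerate.\<close>

lemma cw_expansive_imp_locale:
  fixes X :: "'a::metric_space set"
  assumes peano: "peano_continuum X" and homeo: "homeomorphism X X f g" and cw: "cw_expansive X f"
  obtains e where "cw_expansive_homeomorphism X f g e"
proof -
  obtain \<alpha> where \<alpha>: "\<alpha> > 0" "\<forall>C. C \<subseteq> X \<and> compact C \<and> connected C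
      \<and> (\<exists>x\<in>C. \<exists>y\<in>C. x \<noteq> y) \<longrightarrow> (SUP n::int. diameter (iter_int X f n ` C)) > \<alpha>"
    using cw unfolding cw_expansive_def by (elim exE conjE)
  have X: "compact X" "connected X" "locally connected X" "\<exists>x\<in>X. \<exists>y\<in>X. x \<noteq> y"
    using peano by (auto simp: peano_continuum_def)
  have "cw_expansive_homeomorphism X f g (\<alpha>/2)"
  proof unfold_locales
    fix C c
    assume C: "connected C" "C \<subseteq> X" "c \<in> C"
      and near_f: "\<forall>n. iterate_within f n (\<alpha>/2) c C" and near_g: "\<forall>n. iterate_within g n (\<alpha>/2) c C"
    have closure_sub: "closure C \<subseteq> X"
      using C X by (intro closure_minimal compact_imp_closed)
    \<comment> \<open>Cw-expansivity speaks of compact sets, so the bounds are first carried by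
      continuity from \<open>C\<close> to its closure.\<close>
    have extend: "dist (h c) (h z) \<le> \<alpha>/2"
      if h: "continuous_on X h" and le: "\<forall>z\<in>C. dist (h c) (h z) \<le> \<alpha>/2" and z: "z \<in> closure C" for h :: "'a \<Rightarrow> 'a" and z
    proof -
      have "continuous_on (closure C) (\<lambda>z. dist (h c) (h z))"
        by (intro continuous_on_dist continuous_on_const continuous_on_subset[OF h closure_sub])
      then show ?thesis
        by (rule continuous_le_on_closure[OF _ z]) (use le in blast)
    qed
    show "C \<subseteq> {c}"
    proof (rule ccontr)
      assume "\<not> C \<subseteq> {c}"
      then have "\<exists>x\<in>closure C. \<exists>y\<in>closure C. x \<noteq> y"
        using C closure_subset[of C] by blast
      moreover have "compact (closure C)"
        using closure_sub X(1) by (metis closed_closure compact_Int_closed inf.absorb2)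
      ultimately have "\<alpha> < (SUP n::int. diameter (iter_int X f n ` closure C))"
        using \<alpha>(2) closure_sub C(1) by (simp add: connected_imp_connected_closure)
      moreover have "diameter (iter_int X f n ` closure C) \<le> 2 * (\<alpha>/2)" for n :: int
      proof (rule diameter_le_twice_radius)
        fix u assume "u \<in> iter_int X f n ` closure C"
        then obtain z where z: "z \<in> closure C" "u = iter_int X f n z" by blast
        show "dist (iter_int X f n c) u \<le> \<alpha>/2"
        proof (cases "0 \<le> n")
          case True
          then show ?thesis
            using extend[OF homeomorphism_funpow_continuous[OF homeo] _ z(1)] near_f z
            by (simp add: iter_int_def)
        next
          case False
          moreover have "c \<in> X" "z \<in> X" using C closure_sub z by auto
          ultimately show ?thesis
            using extend[OF homeomorphism_funpow_continuous[OF homeomorphism_symD[OF homeo]] _ z(1)] near_g z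
            by (simp add: iter_int_def inv_into_funpow_eq[OF homeo])
        qed
      qed (use \<alpha> in simp)
      then have "(SUP n::int. diameter (iter_int X f n ` closure C)) \<le> \<alpha>"
        by (intro cSUP_least) auto
      ultimately show False by linarith
    qed
  qed (use X homeo \<alpha> in auto)
  then show thesis by (rule that)
qed

theorem theorem1:
  fixes X :: "'a::metric_space set" and f :: "'a \<Rightarrow> 'a"
  assumes "peano_continuum X"
    and "\<exists>g. homeomorphism X X f g"
    and "cw_expansive X f"
  shows "\<forall>\<epsilon>>0. \<exists>\<delta>>0. (INF x\<in>X. diameter (cw_stable X f \<epsilon> x)) \<ge> \<delta>
                      \<and> (INF x\<in>X. diameter (cw_unstable X f \<epsilon> x)) \<ge> \<delta>"
proof (intro allI impI)
  fix \<epsilon> :: real assume \<epsilon>: "\<epsilon> > 0"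
  obtain g where homeo: "homeomorphism X X f g" using assms(2) by blast
  obtain e where "cw_expansive_homeomorphism X f g e"
    by (rule cw_expansive_imp_locale[OF assms(1) homeo assms(3)])
  then interpret F: cw_expansive_homeomorphism X f g e .
  interpret G: cw_expansive_homeomorphism X g f e by (rule F.swap)
  \<comment> \<open>\<open>inv_into X f\<close> is known to agree with \<open>g\<close> only on
    \<open>X\<close>. With this, unstable sets of \<open>f\<close> are stable sets of
    \<open>g\<close>, and the second bound is the first one for the inverse.\<close>
  have unstable_eq: "unstable_set X f \<epsilon> x = {y\<in>X. \<forall>n. dist ((g ^^ n) x) ((g ^^ n) y) \<le> \<epsilon>}"
    if "x \<in> X" for x
    using that by (auto simp: unstable_set_def inv_into_funpow_eq[OF homeo])
  obtain \<delta>1 where \<delta>1: "\<delta>1 > 0" "\<And>x. x \<in> X \<Longrightarrow> \<delta>1 \<le> diameter (cw_stable X f \<epsilon> x)"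
    by (rule F.component_diameter_ge[OF \<epsilon>], rule that) (simp_all add: cw_stable_def stable_set_def)
  obtain \<delta>2 where \<delta>2: "\<delta>2 > 0" "\<And>x. x \<in> X \<Longrightarrow> \<delta>2 \<le> diameter (cw_unstable X f \<epsilon> x)"
    by (rule G.component_diameter_ge[OF \<epsilon>], rule that) (simp_all add: cw_unstable_def unstable_eq)
  \<comment> \<open>An infimum over the empty set would be an arbitrary real.\<close>
  have "X \<noteq> {}" using F.nontriv by blast
  then have "min \<delta>1 \<delta>2 \<le> (INF x\<in>X. diameter (cw_stable X f \<epsilon> x))"
    "min \<delta>1 \<delta>2 \<le> (INF x\<in>X. diameter (cw_unstable X f \<epsilon> x))"
    using \<delta>1 \<delta>2 by (auto intro!: cINF_greatest simp: min.coboundedI1 min.coboundedI2)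
  then show "\<exists>\<delta>>0. (INF x\<in>X. diameter (cw_stable X f \<epsilon> x)) \<ge> \<delta>
      \<and> (INF x\<in>X. diameter (cw_unstable X f \<epsilon> x)) \<ge> \<delta>"
    using \<delta>1(1) \<delta>2(1) by (intro exI[of _ "min \<delta>1 \<delta>2"]) auto
qed

end
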